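(* Fix a $\Delta^0_0$ formula $\theta(x,y,z)$. There is a primitive recursive function $g:\mathbb{N}\to\mathbb{N}$ such that for every $n\in\mathbb{N}$ and every finite set $X\subseteq\mathbb{N}$, if $X$ is $\omega^{12n^2+12n+6}$-large${}^*(\theta)$ and $g$-sparse, then $X$ is $\mathsf{RT}^2_2$-$\omega^n$-large${}^*(\theta)$, i.e. for every coloring $f:[X]^2\to 2$ there is an $f$-homogeneous subset of $X$ which is $\omega^n$-large${}^*(\theta)$.
   Context: For finite sets $A,B$, write $A<B$ if every element of $A$ is below every element of $B$. Finite sets $E<F$ are $\theta$-apart if $\forall x<\max E\ \exists y<\min F\ \forall z<\max F\ \theta(x,y,z)$. For a family $\mathcal{L}$ of finite subsets of $\mathbb{N}$ and $k\in\mathbb{N}$, $\mathcal{L}\cdot k$ is the family of finite sets $F$ containing $k$ pairwise $\theta$-apart sets $X_0<\dots<X_{k-1}\subseteq F$ each in $\mathcal{L}$; for a finite sequence, $\mathcal{L}\cdot()=\mathcal{L}$ and $\mathcal{L}\cdot(k,k_2,\dots,k_s)=(\mathcal{L}\cdot k)\cdot(k_2,\dots,k_s)$. Let $L^\theta_0$ be the family of nonempty finite sets and $L^\theta_{n+1}$ the family of nonempty finite $X$ with $X\setminus\{\min X\}\in L^\theta_n\cdot(\min X,\dots,\min X)$ ($n+1$ entries). A set is $\omega^n$-large${}^*(\theta)$ if it is in $L^\theta_n$. For $g:\mathbb{N}\to\mathbb{N}$, a set $X$ is $g$-sparse if $g(x)<y$ for all $x<y$ in $X$. A set $H$ is $f$-homogeneous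 if $f$ is constant on $[H]^2$. *)

theory Defs
  imports "HOL-Library.Ramsey"
begin

text \<open>
  Bounded-quantifier formulas of the language of second-order arithmetic. Number variables are
  de Bruijn indices into a list of values; the bounding term of a quantifier is evaluated outside
  the scope of that quantifier. Free set variables are allowed, as is usual for
  $\Delta^0_0$ formulas, and are interpreted by an assignment \<open>S\<close>.
\<close>

datatype tm = Var nat | Zero | One | Plus tm tm | Times tm tm

datatype delta00 =
    Eq tm tm
  | Less tm tm
  | Mem tm nat
  | Neg delta00
  | Conj delta00 delta00
  | Disj delta00 delta00
  | BAll tm delta00
  | BEx tm delta00

primrec tm_val :: "nat list \<Rightarrow> tm \<Rightarrow> nat" where
  "tm_val e (Var i) = e ! i"
| "tm_val e Zero = 0"
| "tm_val e One = 1"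
| "tm_val e (Plus s t) = tm_val e s + tm_val e t"
| "tm_val e (Times s t) = tm_val e s * tm_val e t"

primrec sat :: "(nat \<Rightarrow> nat set) \<Rightarrow> nat list \<Rightarrow> delta00 \<Rightarrow> bool" where
  "sat S e (Eq s t) \<longleftrightarrow> tm_val e s = tm_val e t"
| "sat S e (Less s t) \<longleftrightarrow> tm_val e s < tm_val e t"
| "sat S e (Mem t i) \<longleftrightarrow> tm_val e t \<in> S i"
| "sat S e (Neg p) \<longleftrightarrow> \<not> sat S e p"
| "sat S e (Conj p q) \<longleftrightarrow> sat S e p \<and> sat S e q"
| "sat S e (Disj p q) \<longleftrightarrow> sat S e p \<or> sat S e q"
| "sat S e (BAll t p) \<longleftrightarrow> (\<forall>v < tm_val e t. sat S (v # e) p)"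
| "sat S e (BEx t p) \<longleftrightarrow> (\<exists>v < tm_val e t. sat S (v # e) p)"

text \<open>\<open>scoped k p\<close>: the free number variables of \<open>p\<close> are among the first \<open>k\<close> indices.\<close>

primrec tm_scoped :: "nat \<Rightarrow> tm \<Rightarrow> bool" where
  "tm_scoped k (Var i) \<longleftrightarrow> i < k"
| "tm_scoped k Zero \<longleftrightarrow> True"
| "tm_scoped k One \<longleftrightarrow> True"
| "tm_scoped k (Plus s t) \<longleftrightarrow> tm_scoped k s \<and> tm_scoped k t"
| "tm_scoped k (Times s t) \<longleftrightarrow> tm_scoped k s \<and> tm_scoped k t"

primrec scoped :: "nat \<Rightarrow> delta00 \<Rightarrow> bool" where
  "scoped k (Eq s t) \<longleftrightarrow> tm_scoped k s \<and> tm_scoped k t"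
| "scoped k (Less s t) \<longleftrightarrow> tm_scoped k s \<and> tm_scoped k t"
| "scoped k (Mem t i) \<longleftrightarrow> tm_scoped k t"
| "scoped k (Neg p) \<longleftrightarrow> scoped k p"
| "scoped k (Conj p q) \<longleftrightarrow> scoped k p \<and> scoped k q"
| "scoped k (Disj p q) \<longleftrightarrow> scoped k p \<and> scoped k q"
| "scoped k (BAll t p) \<longleftrightarrow> tm_scoped k t \<and> scoped (Suc k) p"
| "scoped k (BEx t p) \<longleftrightarrow> tm_scoped k t \<and> scoped (Suc k) p"

definition rel3 :: "(nat \<Rightarrow> nat set) \<Rightarrow> delta00 \<Rightarrow> nat \<Rightarrow> nat \<Rightarrow> nat \<Rightarrow> bool" where
  "rel3 S p x y z \<longleftrightarrow> sat S [x, y, z] p"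

text \<open>
  \<open>prim_rec k h\<close>: \<open>h\<close> is a primitive recursive function of \<open>k\<close> arguments, passed as a list;
  only the values of \<open>h\<close> on lists of length \<open>k\<close> are meaningful.
\<close>

inductive prim_rec :: "nat \<Rightarrow> (nat list \<Rightarrow> nat) \<Rightarrow> bool" where
  zero: "prim_rec k (\<lambda>xs. 0)"
| succ: "prim_rec 1 (\<lambda>xs. Suc (xs ! 0))"
| proj: "i < k \<Longrightarrow> prim_rec k (\<lambda>xs. xs ! i)"
| comp: "prim_rec (length gs) h \<Longrightarrow> \<forall>g\<in>set gs. prim_rec k g
    \<Longrightarrow> prim_rec k (\<lambda>xs. h (map (\<lambda>g. g xs) gs))"
| prec: "prim_rec k f \<Longrightarrow> prim_rec (Suc (Suc k)) h
    \<Longrightarrow> prim_rec (Suc k) (\<lambda>xs. rec_nat (f (tl xs)) (\<lambda>y r. h (y # r # tl xs)) (hd xs))"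

definition primitive_recursive :: "(nat \<Rightarrow> nat) \<Rightarrow> bool" where
  "primitive_recursive g \<longleftrightarrow> (\<exists>h. prim_rec 1 h \<and> (\<forall>x. g x = h [x]))"

definition set_below :: "nat set \<Rightarrow> nat set \<Rightarrow> bool" where
  "set_below A B \<longleftrightarrow> (\<forall>a\<in>A. \<forall>b\<in>B. a < b)"

text \<open>
  Only meaningful for nonempty finite sets. This suffices below: starting from nonempty sets, the
  empty set enters a family only through multiplication by \<open>0\<close>, and in \<open>large\<close> all
  multipliers of one step are equal, so no pair of sets is compared in that case.
\<close>

definition apart :: "(nat \<Rightarrow> nat \<Rightarrow> nat \<Rightarrow> bool) \<Rightarrow> nat set \<Rightarrow> nat set \<Rightarrow> bool" where
  "apart \<theta> E F \<longleftrightarrow> set_below E F \<and>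
     (\<forall>x < Max E. \<exists>y < Min F. \<forall>z < Max F. \<theta> x y z)"

definition fam_mult ::
  "(nat \<Rightarrow> nat \<Rightarrow> nat \<Rightarrow> bool) \<Rightarrow> nat set set \<Rightarrow> nat \<Rightarrow> nat set set" where
  "fam_mult \<theta> L k = {F. finite F \<and>
     (\<exists>X :: nat \<Rightarrow> nat set. (\<forall>i<k. X i \<in> L \<and> X i \<subseteq> F) \<and>
        (\<forall>i j. i < j \<and> j < k \<longrightarrow> apart \<theta> (X i) (X j)))}"

primrec fam_mult_list ::
  "(nat \<Rightarrow> nat \<Rightarrow> nat \<Rightarrow> bool) \<Rightarrow> nat set set \<Rightarrow> nat list \<Rightarrow> nat set set" where
  "fam_mult_list \<theta> L [] = L"
| "fam_mult_list \<theta> L (k # ks) = fam_mult_list \<theta> (fam_mult \<theta> L k) ks"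

text \<open>\<open>large \<theta> n\<close> is the family of $\omega^n$-large${}^*(\theta)$ sets.\<close>

primrec large :: "(nat \<Rightarrow> nat \<Rightarrow> nat \<Rightarrow> bool) \<Rightarrow> nat \<Rightarrow> nat set set" where
  "large \<theta> 0 = {X. finite X \<and> X \<noteq> {}}"
| "large \<theta> (Suc n) = {X. finite X \<and> X \<noteq> {} \<and>
     X - {Min X} \<in> fam_mult_list \<theta> (large \<theta> n) (replicate (Suc n) (Min X))}"

definition sparse :: "(nat \<Rightarrow> nat) \<Rightarrow> nat set \<Rightarrow> bool" where
  "sparse g X \<longleftrightarrow> (\<forall>x\<in>X. \<forall>y\<in>X. x < y \<longrightarrow> g x < y)"

definition homogeneous :: "(nat set \<Rightarrow> nat) \<Rightarrow> nat set \<Rightarrow> bool" where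
  "homogeneous f H \<longleftrightarrow> (\<exists>c. \<forall>e \<in> nsets H 2. f e = c)"

definition RT22_large :: "(nat \<Rightarrow> nat \<Rightarrow> nat \<Rightarrow> bool) \<Rightarrow> nat \<Rightarrow> nat set \<Rightarrow> bool" where
  "RT22_large \<theta> n X \<longleftrightarrow> (\<forall>f. f \<in> nsets X 2 \<rightarrow> {..<2::nat} \<longrightarrow>
     (\<exists>H \<subseteq> X. homogeneous f H \<and> H \<in> large \<theta> n))"

end

theory Submission
  imports Defs
begin

text \<open>
  A set in $L^\theta_{n+1}$ is a root followed by a tree of pairwise apart blocks. Call it grouped if
  the colouring is constant between the root and the rest, between any two sibling blocks of the same
  node, and hereditarily so. All constraints on a block coming from its surroundings can be
  merged into a single colouring, whose number of colours is small compared to the minimum of the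
  block by sparsity. Hence each level of nesting costs just one exponent, and
  $L^\theta_{n(n+3)/2}$ yields grouped sets of exponent $n$. In a grouped set of exponent $4n$ the
  colours of roots and nodes are chosen by a finite Ramsey-type recursion, which produces a homogeneous
  set in $L^\theta_n$. The total exponent is $2n(4n+3) \le 12n^2+12n+5$; the remaining
  exponent serves to discard the element 1.
\<close>

subsection \<open>Closure properties of the largeness families\<close>

definition upclosed :: "nat set set \<Rightarrow> bool" where
  "upclosed L \<longleftrightarrow> (\<forall>A B. A \<in> L \<longrightarrow> A \<subseteq> B \<longrightarrow> finite B \<longrightarrow> B \<in> L)"

lemma upclosedD: "upclosed L \<Longrightarrow> A \<in> L \<Longrightarrow> A \<subseteq> B \<Longrightarrow> finite B \<Longrightarrow> B \<in> L"
  unfolding upclosed_def by blast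

text \<open>Shrinking lowers both maxima and raises \<open>Min F\<close>: the universal ranges
  shrink and the existential range grows. Nonemptiness keeps \<open>Max\<close> and
  \<open>Min\<close> meaningful.\<close>

lemma apart_subset:
  assumes "apart \<theta> E F" "E' \<subseteq> E" "F' \<subseteq> F" "E' \<noteq> {}" "F' \<noteq> {}" "finite E" "finite F"
  shows "apart \<theta> E' F'"
proof -
  have "Max E' \<le> Max E" "Max F' \<le> Max F" "Min F \<le> Min F'"
    using assms by (auto intro: Max_mono Min_antimono)
  then have "\<forall>x < Max E'. \<exists>y < Min F'. \<forall>z < Max F'. \<theta> x y z"
    using assms(1) unfolding apart_def by (meson less_le_trans)
  then show ?thesis
    using assms(1-3) unfolding apart_def set_below_def by blast
qed

lemma apart_less: "apart \<theta> E F \<Longrightarrow> x \<in> E \<Longrightarrow> y \<in> F \<Longrightarrow> x < y"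
  unfolding apart_def set_below_def by blast

text \<open>A tree of \<open>d\<close> levels with \<open>k\<close>-fold branching and leaves in
  \<open>L\<close>. Written as a power of \<open>fam_mult\<close>, so that induction on
  \<open>d\<close> peels off the root node.\<close>

definition nest ::
  "(nat \<Rightarrow> nat \<Rightarrow> nat \<Rightarrow> bool) \<Rightarrow> nat \<Rightarrow> nat \<Rightarrow> nat set set \<Rightarrow> nat set set" where
  "nest \<theta> k d L = ((\<lambda>A. fam_mult \<theta> A k) ^^ d) L"

lemma nest_0 [simp]: "nest \<theta> k 0 L = L"
  by (simp add: nest_def)

lemma nest_Suc: "nest \<theta> k (Suc d) L = fam_mult \<theta> (nest \<theta> k d L) k"
  by (simp add: nest_def)

text \<open>The list version applies the first multiplier innermost; for equal multipliers the order
  is immaterial.\<close>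

lemma fam_mult_list_replicate: "fam_mult_list \<theta> L (replicate d k) = nest \<theta> k d L"
  by (induction d arbitrary: L) (simp_all add: nest_def funpow_swap1[of "\<lambda>A. fam_mult \<theta> A k"])

lemma large_Suc: "large \<theta> (Suc n) =
    {X. finite X \<and> X \<noteq> {} \<and> X - {Min X} \<in> nest \<theta> (Min X) (Suc n) (large \<theta> n)}"
  by (simp only: large.simps fam_mult_list_replicate)

lemma large_finite_nonempty: "X \<in> large \<theta> n \<Longrightarrow> finite X \<and> X \<noteq> {}"
  by (cases n) auto

lemma fam_multI:
  assumes "finite F" "\<And>i. i < k \<Longrightarrow> X i \<in> L" "\<And>i. i < k \<Longrightarrow> X i \<subseteq> F"
    "\<And>i j. i < j \<Longrightarrow> j < k \<Longrightarrow> apart \<theta> (X i) (X j)"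
  shows "F \<in> fam_mult \<theta> L k"
  using assms unfolding fam_mult_def by (intro CollectI conjI exI[of _ X]) simp_all

lemma upclosed_fam_mult: "upclosed (fam_mult \<theta> L k)"
  unfolding upclosed_def fam_mult_def by blast

lemma fam_mult_antimono:
  assumes "F \<in> fam_mult \<theta> L k" "L \<subseteq> L'" "k' \<le> k"
  shows "F \<in> fam_mult \<theta> L' k'"
proof -
  obtain X where X': "finite F" "\<forall>i<k. X i \<in> L \<and> X i \<subseteq> F"
      "\<forall>i j. i < j \<and> j < k \<longrightarrow> apart \<theta> (X i) (X j)"
    using assms(1) unfolding fam_mult_def by auto
  have X: "finite F"
    "\<And>i. i < k \<Longrightarrow> X i \<in> L"
    "\<And>i. i < k \<Longrightarrow> X i \<subseteq> F"
    "\<And>i j. i < j \<Longrightarrow> j < k \<Longrightarrow> apart \<theta> (X i) (X j)"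
    using X' by auto
  show ?thesis
    using X assms(2,3) by (intro fam_multI[of F k' X]) auto
qed

lemma nest_antimono: "k' \<le> k \<Longrightarrow> nest \<theta> k d L \<subseteq> nest \<theta> k' d L"
proof (induction d)
  case (Suc d)
  then show ?case
    unfolding nest_Suc using fam_mult_antimono by blast
qed simp

lemma nest_leaf: "F \<in> nest \<theta> k d L \<Longrightarrow> 0 < k \<Longrightarrow> \<exists>E \<subseteq> F. E \<in> L"
proof (induction d arbitrary: F)
  case (Suc d)
  then obtain E where "E \<subseteq> F" "E \<in> nest \<theta> k d L"
    unfolding nest_Suc fam_mult_def by blast
  then show ?case
    using Suc by (meson subset_trans)
qed auto

text \<open>The root \<open>x\<close> need not be the minimum: \<open>Min X \<le> x\<close> only
  asks for less branching, and \<open>H\<close> still lies above it. Upward closure follows from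
  this.\<close>

lemma large_SucI:
  assumes "finite X" "x \<in> X" "H \<subseteq> X" "\<forall>y\<in>H. x < y" "H \<in> nest \<theta> x (Suc n) (large \<theta> n)"
  shows "X \<in> large \<theta> (Suc n)"
proof -
  have le: "Min X \<le> x"
    using assms by simp
  have "H \<in> nest \<theta> (Min X) (Suc n) (large \<theta> n)"
    using assms(5) nest_antimono[OF le] by blast
  moreover have "H \<subseteq> X - {Min X}"
  proof
    fix y assume "y \<in> H"
    then have "y \<in> X" "x < y"
      using assms(3,4) by auto
    then show "y \<in> X - {Min X}"
      using le by (simp del: Min_le)
  qed
  ultimately have "X - {Min X} \<in> nest \<theta> (Min X) (Suc n) (large \<theta> n)"
    unfolding nest_Suc using upclosedD[OF upclosed_fam_mult] finite_Diff[OF assms(1)] by blast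
  then show ?thesis
    unfolding large_Suc using assms by blast
qed

lemma upclosed_large: "upclosed (large \<theta> n)"
proof (cases n)
  case 0
  then show ?thesis
    unfolding upclosed_def by auto
next
  case (Suc n')
  show ?thesis
    unfolding upclosed_def
  proof (intro allI impI)
    fix A B assume A: "A \<in> large \<theta> n" and "A \<subseteq> B" "finite B"
    then have fin: "finite A" "A \<noteq> {}"
      and n: "A - {Min A} \<in> nest \<theta> (Min A) (Suc n') (large \<theta> n')"
      unfolding Suc large_Suc by auto
    have "\<forall>y\<in>A - {Min A}. Min A < y"
      using fin by (metis DiffD1 DiffD2 Min_le insertI1 le_neq_implies_less)
    then show "B \<in> large \<theta> n"
      unfolding Suc using Min_in[OF fin] \<open>A \<subseteq> B\<close> \<open>finite B\<close> n
      by (intro large_SucI[of B "Min A" "A - {Min A}"]) auto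
  qed
qed

text \<open>This is how one exponent is spent: the top branching is kept and each child is thinned
  to a single leaf. As \<open>0 \<notin> X\<close>, the branching \<open>Min X\<close> is positive,
  so these leaves exist.\<close>

lemma large_blocks:
  assumes "X \<in> large \<theta> (Suc s)" "0 \<notin> X"
  shows "0 < Min X \<and> (\<exists>Z. (\<forall>i<Min X. Z i \<in> large \<theta> s \<and> Z i \<subseteq> X - {Min X}) \<and>
     (\<forall>i j. i < j \<and> j < Min X \<longrightarrow> apart \<theta> (Z i) (Z j)))"
proof -
  have fin: "finite X" "X \<noteq> {}"
    using assms(1) large_finite_nonempty by auto
  then have pos: "0 < Min X"
    using assms(2) Min_in by (metis gr0I)
  have "X - {Min X} \<in> fam_mult \<theta> (nest \<theta> (Min X) s (large \<theta> s)) (Min X)"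
    using assms(1) unfolding large_Suc nest_Suc by auto
  then obtain W where W': "\<forall>i<Min X. W i \<in> nest \<theta> (Min X) s (large \<theta> s) \<and> W i \<subseteq> X - {Min X}"
      "\<forall>i j. i < j \<and> j < Min X \<longrightarrow> apart \<theta> (W i) (W j)"
    unfolding fam_mult_def by auto
  have W: "\<And>i. i < Min X \<Longrightarrow> W i \<in> nest \<theta> (Min X) s (large \<theta> s)"
    "\<And>i. i < Min X \<Longrightarrow> W i \<subseteq> X - {Min X}"
    "\<And>i j. i < j \<Longrightarrow> j < Min X \<Longrightarrow> apart \<theta> (W i) (W j)"
    using W' by auto
  have "\<exists>E. i < Min X \<longrightarrow> E \<subseteq> W i \<and> E \<in> large \<theta> s" for i
    using nest_leaf[OF W(1) pos] by blast
  then obtain Z where Z: "\<And>i. i < Min X \<Longrightarrow> Z i \<subseteq> W i \<and> Z i \<in> large \<theta> s"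
    by metis
  have "apart \<theta> (Z i) (Z j)" if "i < j" "j < Min X" for i j
  proof (rule apart_subset)
    have i: "i < Min X"
      using that by (rule less_trans)
    show "apart \<theta> (W i) (W j)"
      using W(3) that .
    show "Z i \<subseteq> W i" "Z j \<subseteq> W j" "Z i \<noteq> {}" "Z j \<noteq> {}"
      using Z[OF i] Z[OF that(2)] large_finite_nonempty by auto
    show "finite (W i)" "finite (W j)"
      using finite_subset[OF W(2)[OF i]] finite_subset[OF W(2)[OF that(2)]] fin(1) by auto
  qed
  moreover have "Z i \<in> large \<theta> s \<and> Z i \<subseteq> X - {Min X}" if "i < Min X" for i
    using Z[OF that] W(2)[OF that] by blast
  ultimately show ?thesis
    using pos by (intro conjI exI[of _ Z]) simp_all
qed

lemma large_SucD:
  assumes "X \<in> large \<theta> (Suc s)" "0 \<notin> X"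
  shows "\<exists>Z \<subseteq> X - {Min X}. Z \<in> large \<theta> s"
  using large_blocks[OF assms] by blast

lemma large_mono:
  assumes "X \<in> large \<theta> s" "0 \<notin> X" "s' \<le> s"
  shows "X \<in> large \<theta> s'"
  using assms(3,1)
proof (induction rule: dec_induct)
  case (step s)
  then obtain Z where "Z \<subseteq> X" "Z \<in> large \<theta> s"
    using large_SucD[OF step.prems assms(2)] by blast
  then show ?case
    using step upclosed_large upclosedD large_finite_nonempty by blast
qed

section \<open>Ramsey's theorem for pairs with an exponential bound\<close>

text \<open>Induction on the sum of the two targets: the least vertex splits the others by colour,
  and a large enough class is treated with the target of its colour lowered by one. The function
  \<open>s\<close> handles both colours at once.\<close>

lemma ramsey_pairs:
  fixes e :: "nat \<Rightarrow> nat \<Rightarrow> bool" and s :: "bool \<Rightarrow> nat"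
  assumes "finite I" "2 ^ (s True + s False) \<le> card I"
  shows "\<exists>c. \<exists>J \<subseteq> I. card J = s c \<and> (\<forall>i\<in>J. \<forall>j\<in>J. i < j \<longrightarrow> e i j = c)"
  using assms
proof (induction "s True + s False" arbitrary: s I)
  case 0
  then show ?case
    by (intro exI[of _ True] exI[of _ "{}"]) simp
next
  case (Suc M)
  show ?case
  proof (cases "\<exists>c. s c = 0")
    case True
    then show ?thesis
      by (metis card.empty empty_iff empty_subsetI)
  next
    case False
    then have pos: "0 < s c" for c
      by simp
    have ne: "I \<noteq> {}"
      using Suc.prems by auto
    define i where "i = Min I"
    define K where "K = (\<lambda>c. {j \<in> I - {i}. e i j = c})"
    have iI: "i \<in> I" and less: "\<forall>j\<in>I - {i}. i < j"
      using Suc.prems ne unfolding i_def by (auto simp: order_less_le)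
    have finK: "finite (K c)" for c
      unfolding K_def using Suc.prems by simp
    have "K True \<union> K False = I - {i}" "K True \<inter> K False = {}"
      unfolding K_def by auto
    then have "card (K True) + card (K False) = card I - 1"
      by (metis card_Un_disjoint card_Diff_singleton finK iI)
    moreover have "2 * 2 ^ M \<le> card I"
      using Suc.prems(2) Suc.hyps(2) by (metis power_Suc)
    moreover have "(1::nat) \<le> 2 ^ M"
      by simp
    \<comment> \<open>Two classes smaller than \<open>2 ^ M\<close> would hold at most
      \<open>2 * 2 ^ M - 2\<close> points, but at least \<open>2 * 2 ^ M - 1\<close> remain after
      removing \<open>i\<close>.\<close>
    ultimately have "2 ^ M \<le> card (K True) \<or> 2 ^ M \<le> card (K False)"
      by linarith
    then obtain c where c: "2 ^ M \<le> card (K c)"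
      by blast
    define s' where "s' = s(c := s c - 1)"
    have M: "M = s' True + s' False"
      using pos[of True] pos[of False] Suc.hyps(2) unfolding s'_def by (cases c) auto
    obtain c' J where J: "J \<subseteq> K c" "card J = s' c'" "\<forall>i\<in>J. \<forall>j\<in>J. i < j \<longrightarrow> e i j = c'"
      using Suc.hyps(1)[OF M finK] c M by metis
    show ?thesis
    proof (cases "c' = c")
      case True
      have "i \<notin> J" "finite J" "\<forall>j\<in>J. i < j \<and> e i j = c"
        using J(1) less finK finite_subset unfolding K_def by (auto intro: finite_subset)
      then have "card (insert i J) = s c"
        using J(2) True False unfolding s'_def by simp
      moreover have "\<forall>x\<in>insert i J. \<forall>y\<in>insert i J. x < y \<longrightarrow> e x y = c"
        using J(3) True \<open>\<forall>j\<in>J. i < j \<and> e i j = c\<close> by (metis insertE less_asym less_irrefl)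
      moreover have "insert i J \<subseteq> I"
        using J(1) iI unfolding K_def by blast
      ultimately show ?thesis
        by blast
    next
      case False
      then have "card J = s c'"
        using J(2) unfolding s'_def by simp
      moreover have "J \<subseteq> I"
        using J(1) unfolding K_def by blast
      ultimately show ?thesis
        using J(3) by blast
    qed
  qed
qed

lemma strict_mono_enumeration:
  fixes J :: "nat set"
  assumes "finite J"
  shows "\<exists>h. (\<forall>i<card J. h i \<in> J) \<and> (\<forall>i j. i < j \<and> j < card J \<longrightarrow> h i < (h j :: nat))"
proof (intro exI conjI allI impI)
  fix i assume "i < card J"
  then show "sorted_list_of_set J ! i \<in> J"
    using assms by (metis nth_mem set_sorted_list_of_set length_sorted_list_of_set)
next
  fix i j assume "i < j \<and> j < card J"
  then show "sorted_list_of_set J ! i < sorted_list_of_set J ! j"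
    by (metis sorted_wrt_nth_less strict_sorted_list_of_set length_sorted_list_of_set)
qed

subsection \<open>Grouped large sets\<close>

context
  fixes \<theta> :: "nat \<Rightarrow> nat \<Rightarrow> nat \<Rightarrow> bool" and R :: "nat \<Rightarrow> nat \<Rightarrow> bool"
begin

definition cmult :: "bool \<Rightarrow> nat set set \<Rightarrow> nat \<Rightarrow> nat set set" where
  "cmult c L k = {F. finite F \<and> (\<exists>X. (\<forall>i<k. X i \<in> L \<and> X i \<subseteq> F) \<and>
     (\<forall>i j. i < j \<and> j < k \<longrightarrow> apart \<theta> (X i) (X j) \<and> (\<forall>x\<in>X i. \<forall>y\<in>X j. R x y = c)))}"

lemma cmultI:
  assumes "finite F" "\<And>i. i < k \<Longrightarrow> X i \<in> L" "\<And>i. i < k \<Longrightarrow> X i \<subseteq> F"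
    "\<And>i j. i < j \<Longrightarrow> j < k \<Longrightarrow> apart \<theta> (X i) (X j)"
    "\<And>i j x y. i < j \<Longrightarrow> j < k \<Longrightarrow> x \<in> X i \<Longrightarrow> y \<in> X j \<Longrightarrow> R x y = c"
  shows "F \<in> cmult c L k"
  using assms unfolding cmult_def by (intro CollectI conjI exI[of _ X]) blast+

definition gmult :: "nat set set \<Rightarrow> nat \<Rightarrow> nat set set" where
  "gmult L k = (\<Union>c. cmult c L k)"

text \<open>One colour for all nodes, in contrast to \<open>gnest\<close>, where each node has its
  own. Lemma \<open>gnest_cnest\<close> passes from the latter to the former.\<close>

definition cnest :: "bool \<Rightarrow> nat \<Rightarrow> nat \<Rightarrow> nat set set \<Rightarrow> nat set set" where
  "cnest c k d L = ((\<lambda>A. cmult c A k) ^^ d) L"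

definition gnest :: "nat \<Rightarrow> nat \<Rightarrow> nat set set \<Rightarrow> nat set set" where
  "gnest k d L = ((\<lambda>A. gmult A k) ^^ d) L"

lemma cnest_0 [simp]: "cnest c k 0 L = L"
  by (simp add: cnest_def)

lemma cnest_Suc: "cnest c k (Suc d) L = cmult c (cnest c k d L) k"
  by (simp add: cnest_def)

lemma gnest_0 [simp]: "gnest k 0 L = L"
  by (simp add: gnest_def)

lemma gnest_Suc: "gnest k (Suc d) L = gmult (gnest k d L) k"
  by (simp add: gnest_def)

text \<open>Root and nest are arbitrary witnesses inside \<open>X\<close> rather than
  \<open>Min X\<close> and \<open>X - {Min X}\<close>; upward closure is then immediate.\<close>

primrec glarge :: "nat \<Rightarrow> nat set set" where
  "glarge 0 = {X. finite X \<and> X \<noteq> {}}"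
| "glarge (Suc n) = {X. finite X \<and> (\<exists>x\<in>X. \<exists>c. \<exists>Y \<subseteq> X.
     (\<forall>y\<in>Y. x < y \<and> R x y = c) \<and> Y \<in> gnest x (Suc n) (glarge n))}"

lemma glarge_finite_nonempty: "X \<in> glarge n \<Longrightarrow> finite X \<and> X \<noteq> {}"
  by (cases n) auto

declare glarge.simps(2) [simp del]

lemma upclosed_glarge: "upclosed (glarge n)"
proof (cases n)
  case 0
  then show ?thesis
    unfolding upclosed_def by auto
next
  case (Suc n')
  show ?thesis
    unfolding upclosed_def
  proof (intro allI impI)
    fix A B assume A: "A \<in> glarge n" "A \<subseteq> B" "finite B"
    obtain x c Y where "x \<in> A" "Y \<subseteq> A" "\<forall>y\<in>Y. x < y \<and> R x y = c"
      "Y \<in> gnest x (Suc n') (glarge n')"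
      using A(1) unfolding Suc glarge.simps by auto
    then show "B \<in> glarge n"
      using A(2,3) unfolding Suc glarge.simps
      by (intro CollectI conjI bexI[of _ x] exI[of _ c] exI[of _ Y]) auto
  qed
qed

lemma upclosed_cmult: "upclosed (cmult c L k)"
  unfolding upclosed_def cmult_def by blast

lemma cmult_antimono:
  assumes "F \<in> cmult c L k" "L \<subseteq> L'" "k' \<le> k"
  shows "F \<in> cmult c L' k'"
proof -
  obtain X where X': "finite F" "\<forall>i<k. X i \<in> L \<and> X i \<subseteq> F"
      "\<forall>i j. i < j \<and> j < k \<longrightarrow> apart \<theta> (X i) (X j) \<and> (\<forall>x\<in>X i. \<forall>y\<in>X j. R x y = c)"
    using assms(1) unfolding cmult_def by auto
  have X: "finite F"
    "\<And>i. i < k \<Longrightarrow> X i \<in> L"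
    "\<And>i. i < k \<Longrightarrow> X i \<subseteq> F"
    "\<And>i j. i < j \<Longrightarrow> j < k \<Longrightarrow> apart \<theta> (X i) (X j)"
    "\<And>i j x y. i < j \<Longrightarrow> j < k \<Longrightarrow> x \<in> X i \<Longrightarrow> y \<in> X j \<Longrightarrow> R x y = c"
    using X' by auto
  have "i < k" if "i < k'" for i
    using that assms(3) by simp
  then show ?thesis
    using X assms(2) by (intro cmultI[of F k' X]) blast+
qed

lemma gnest_antimono: "k' \<le> k \<Longrightarrow> gnest k d L \<subseteq> gnest k' d L"
proof (induction d)
  case (Suc d)
  show ?case
  proof
    fix F assume "F \<in> gnest k (Suc d) L"
    then obtain c where "F \<in> cmult c (gnest k d L) k"
      unfolding gnest_Suc gmult_def by auto
    then have "F \<in> cmult c (gnest k' d L) k'"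
      using cmult_antimono Suc.IH[OF Suc.prems] Suc.prems by metis
    then show "F \<in> gnest k' (Suc d) L"
      unfolding gnest_Suc gmult_def by auto
  qed
qed simp

lemma gnest_leaf: "F \<in> gnest k d L \<Longrightarrow> 0 < k \<Longrightarrow> \<exists>E \<subseteq> F. E \<in> L"
proof (induction d arbitrary: F)
  case (Suc d)
  then obtain E where "E \<subseteq> F" "E \<in> gnest k d L"
    unfolding gnest_Suc gmult_def cmult_def by auto
  then show ?case
    using Suc by (meson subset_trans)
qed auto

lemma gnest_finite: "F \<in> gnest k d (glarge n) \<Longrightarrow> finite F"
  by (cases d) (auto simp: gnest_Suc gmult_def cmult_def glarge_finite_nonempty)

lemma glarge_SucD:
  assumes "X \<in> glarge (Suc n)" "0 \<notin> X"
  shows "X \<in> glarge n"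
proof -
  obtain x Y where x: "finite X" "x \<in> X" "Y \<subseteq> X" "Y \<in> gnest x (Suc n) (glarge n)"
    using assms(1) unfolding glarge.simps by auto
  then have "0 < x"
    using assms(2) by (metis gr0I)
  then obtain E where "E \<subseteq> Y" "E \<in> glarge n"
    using gnest_leaf x(4) by blast
  then show ?thesis
    using x upclosedD[OF upclosed_glarge] by (meson subset_trans)
qed

subsection \<open>Extracting grouped large sets\<close>

text \<open>The factor \<open>4 ^ p\<close> is a bound for the Ramsey number of \<open>p\<close> and \<open>p\<close>.\<close>

definition splits :: "nat \<Rightarrow> (nat \<Rightarrow> nat set set) \<Rightarrow> bool" where
  "splits s \<L> \<longleftrightarrow> (\<forall>B k p (c :: nat \<Rightarrow> nat). B \<in> large \<theta> s \<longrightarrow> sparse (\<lambda>x. 32 ^ x) B \<longrightarrow>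
     0 < k \<longrightarrow> card (c ` B) \<le> k \<longrightarrow> k * 4 ^ p < Min B \<longrightarrow>
     (\<exists>H \<subseteq> B. H \<in> \<L> p \<and> (\<forall>x\<in>H. \<forall>y\<in>H. c x = c y)))"

text \<open>\<open>splits\<close> fixes natural numbers as colours, since HOL has no quantification
  over types; an injection of the finite image into the naturals recovers arbitrary colours.\<close>

lemma splitsD:
  fixes c :: "nat \<Rightarrow> 'b"
  assumes "splits s \<L>" "B \<in> large \<theta> s" "sparse (\<lambda>x. 32 ^ x) B"
    "0 < k" "card (c ` B) \<le> k" "k * 4 ^ p < Min B"
  shows "\<exists>H \<subseteq> B. H \<in> \<L> p \<and> (\<forall>x\<in>H. \<forall>y\<in>H. c x = c y)"
proof -
  have "finite (c ` B)"
    using assms(2) large_finite_nonempty by blast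
  then obtain h :: "'b \<Rightarrow> nat" where h: "inj_on h (c ` B)"
    using finite_imp_inj_to_nat_seg by blast
  have "card ((\<lambda>x. h (c x)) ` B) \<le> k"
    using assms(5) h by (metis card_image image_image)
  then obtain H where "H \<subseteq> B" "H \<in> \<L> p" "\<forall>x\<in>H. \<forall>y\<in>H. h (c x) = h (c y)"
    using assms(1)[unfolded splits_def, rule_format, OF assms(2-4) _ assms(6)] by blast
  then show ?thesis
    using h by (metis (no_types, lifting) image_eqI inj_onD subsetD)
qed

text \<open>The witness \<open>q\<close> is the largest element of \<open>B\<close> below
  \<open>Z\<close>. Subsets of \<open>{..q}\<close> thus record the colours towards all earlier
  points of \<open>B\<close>, and sparsity makes their number small against
  \<open>Min Z\<close>.\<close>

lemma gap_below:
  assumes "sparse (\<lambda>x. 32 ^ x) B" "finite B" "Z \<subseteq> B - {Min B}" "Z \<noteq> {}"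
  shows "\<exists>q. Min B \<le> q \<and> 32 ^ q < Min Z \<and> (\<forall>b\<in>B. b < Min Z \<longrightarrow> b \<le> q)"
proof -
  define S where "S = {b \<in> B. b < Min Z}"
  have finZ: "finite Z"
    using assms finite_subset by blast
  have zB: "Min Z \<in> B" "Min Z \<noteq> Min B"
    using finZ assms(3,4) Min_in by blast+
  have "B \<noteq> {}"
    using zB by auto
  then have "Min B \<in> S"
    unfolding S_def using Min_le[OF assms(2) zB(1)] zB(2) Min_in[OF assms(2)] by simp
  moreover have "finite S"
    unfolding S_def using assms(2) by simp
  ultimately have "Max S \<in> S" "Min B \<le> Max S" "\<forall>b\<in>S. b \<le> Max S"
    by (auto intro: Max_in)
  then have "32 ^ Max S < Min Z"
    using assms(1) zB(1) unfolding sparse_def S_def by blast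
  then show ?thesis
    using \<open>Min B \<le> Max S\<close> \<open>\<forall>b\<in>S. b \<le> Max S\<close> unfolding S_def by blast
qed

lemma sparse_subset: "sparse g B \<Longrightarrow> Z \<subseteq> B \<Longrightarrow> sparse g Z"
  unfolding sparse_def by blast

text \<open>The blocks \<open>Z j\<close> are thinned out from the last one to the first: each \<open>H j\<close> is given
  a constant type over everything below \<open>Z j\<close> and, at the same time, a constant colour
  towards every later \<open>H i\<close>. Treating all these conditions as one colouring is what keeps the cost at
  one exponent.\<close>

lemma splits_gmult:
  assumes sp: "splits s \<L>" and ne: "\<And>p. 0 < p \<Longrightarrow> {} \<notin> \<L> p"
  shows "splits (Suc s) (\<lambda>p. gmult (\<L> p) p)"
  unfolding splits_def
proof (intro allI impI)
  fix B k p and c :: "nat \<Rightarrow> nat"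
  assume B: "B \<in> large \<theta> (Suc s)" and spB: "sparse (\<lambda>x. 32 ^ x) B"
    and k: "0 < k" "card (c ` B) \<le> k" "k * 4 ^ p < Min B"
  define m where "m = Min B"
  have fin: "finite B" "B \<noteq> {}"
    using B large_finite_nonempty by auto
  have "0 \<notin> B"
    using k(3) fin(1) by (metis Min_le less_nat_zero_code less_le_trans)
  then obtain Z where Z: "\<forall>i<m. Z i \<in> large \<theta> s \<and> Z i \<subseteq> B - {m}"
    "\<forall>i j. i < j \<and> j < m \<longrightarrow> apart \<theta> (Z i) (Z j)"
    using large_blocks[OF B] unfolding m_def by blast
  have neZ: "finite (Z i)" "Z i \<noteq> {}" "Z i \<subseteq> B" if "i < m" for i
    using Z(1) that large_finite_nonempty by blast+
  have "\<exists>q. m \<le> q \<and> 32 ^ q < Min (Z i) \<and> (\<forall>b\<in>B. b < Min (Z i) \<longrightarrow> b \<le> q)"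
    if i: "i < m" for i
  proof -
    have "Z i \<subseteq> B - {Min B}"
      using Z(1) i unfolding m_def by blast
    then show ?thesis
      using gap_below[OF spB fin(1) _ neZ(2)[OF i]] unfolding m_def by blast
  qed
  then obtain q where q: "\<And>i. i < m \<Longrightarrow> m \<le> q i \<and> 32 ^ q i < Min (Z i) \<and>
      (\<forall>b\<in>B. b < Min (Z i) \<longrightarrow> b \<le> q i)"
    by metis
  have below: "v \<le> q j" if "i < j" "j < m" "v \<in> Z i" for i j v
  proof -
    have "v < Min (Z j)"
      using apart_less Z(2) that neZ(1,2)[OF that(2)] by (metis Min_in)
    then show ?thesis
      using q[OF that(2)] neZ(3)[of i] that by auto
  qed
  show "\<exists>H \<subseteq> B. H \<in> gmult (\<L> p) p \<and> (\<forall>x\<in>H. \<forall>y\<in>H. c x = c y)"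
  \<comment> \<open>For \<open>p = 0\<close> the product asks for no blocks and contains the empty
    set; otherwise \<open>ne\<close> makes every \<open>H j\<close> nonempty.\<close>
  proof (cases "p = 0")
    case True
    then have "{} \<in> gmult (\<L> p) p"
      unfolding gmult_def cmult_def by simp
    then show ?thesis
      by blast
  next
    case False
    \<comment> \<open>For \<open>x \<le> q i\<close> the value \<open>R x w\<close> will not depend
      on \<open>w \<in> H i\<close>, so \<open>\<exists>w\<in>H i. R x w\<close> is the colour of
      \<open>x\<close> towards the whole of \<open>H i\<close>.\<close>
    define P where "P = (\<lambda>H j. H j \<subseteq> Z j \<and> H j \<in> \<L> p \<and>
        (\<forall>x\<in>H j. \<forall>y\<in>H j. c x = c y \<and> (\<forall>v\<le>q j. R v x = R v y) \<and>
           (\<forall>i. j < i \<and> i < m \<longrightarrow> (\<exists>w\<in>H i. R x w) = (\<exists>w\<in>H i. R y w))))"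
    have PI: "P H j" if "H j \<subseteq> Z j" "H j \<in> \<L> p"
      "\<And>x y. x \<in> H j \<Longrightarrow> y \<in> H j \<Longrightarrow> c x = c y"
      "\<And>x y v. x \<in> H j \<Longrightarrow> y \<in> H j \<Longrightarrow> v \<le> q j \<Longrightarrow> R v x = R v y"
      "\<And>x y i. x \<in> H j \<Longrightarrow> y \<in> H j \<Longrightarrow> j < i \<Longrightarrow> i < m
         \<Longrightarrow> (\<exists>w\<in>H i. R x w) = (\<exists>w\<in>H i. R y w)" for H j
      unfolding P_def using that(1,2)
      by (intro conjI ballI allI impI) (simp, simp, rule that(3), simp, simp, rule that(4), simp,
          simp, simp, rule that(5), simp_all)
    have PD: "H j \<subseteq> Z j" "H j \<in> \<L> p"
      "\<And>x y. x \<in> H j \<Longrightarrow> y \<in> H j \<Longrightarrow> c x = c y"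
      "\<And>x y v. x \<in> H j \<Longrightarrow> y \<in> H j \<Longrightarrow> v \<le> q j \<Longrightarrow> R v x = R v y"
      "\<And>x y i. x \<in> H j \<Longrightarrow> y \<in> H j \<Longrightarrow> j < i \<Longrightarrow> i < m
         \<Longrightarrow> (\<exists>w\<in>H i. R x w) = (\<exists>w\<in>H i. R y w)" if "P H j" for H j
      using that unfolding P_def by blast+
    \<comment> \<open>Downward recursion: \<open>r\<close> counts the blocks treated so far,
      starting from the last, so the later \<open>H i\<close> mentioned in \<open>P H j\<close>
      already exist.\<close>
    have "\<exists>H. \<forall>j. m - r \<le> j \<and> j < m \<longrightarrow> P H j"
      if "r \<le> m" for r
      using that
    proof (induction r)
      case 0
      then show ?case
        by auto
    next
      case (Suc r)
      define j0 where "j0 = m - Suc r"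
      have j0: "j0 < m" "m - r = Suc j0"
        unfolding j0_def using Suc by auto
      obtain H where H: "\<forall>j. Suc j0 \<le> j \<and> j < m \<longrightarrow> P H j"
        using Suc.IH[OF Suc_leD[OF Suc.prems]] unfolding j0(2) by blast
      \<comment> \<open>The three conditions of \<open>P\<close> as one colouring of
        \<open>Z j0\<close>; recording colour patterns as sets gives at most
        \<open>k * 2 ^ Suc (q j0) * 2 ^ m\<close> values.\<close>
      define C where "C = (\<lambda>u. (c u, {v. v \<le> q j0 \<and> R v u},
          {i. j0 < i \<and> i < m \<and> (\<exists>w\<in>H i. R u w)}))"
      have "C ` Z j0 \<subseteq> c ` B \<times> Pow {..q j0} \<times> Pow {..<m}"
        unfolding C_def using neZ(3)[OF j0(1)] by auto
      then have "card (C ` Z j0) \<le> card (c ` B \<times> Pow {..q j0} \<times> Pow {..<m})"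
        using fin(1) by (intro card_mono) auto
      also have "\<dots> = card (c ` B) * (2 ^ Suc (q j0) * 2 ^ m)"
        by (simp add: card_cartesian_product card_Pow)
      also have "\<dots> \<le> k * (2 ^ Suc (q j0) * 2 ^ m)"
        using k(2) by simp
      finally have card: "card (C ` Z j0) \<le> k * (2 ^ Suc (q j0) * 2 ^ m)" .
      have mq: "m \<le> q j0" "0 < m"
        using q[OF j0(1)] j0(1) by auto
      \<comment> \<open>As \<open>k * 4 ^ p < m \<le> q j0\<close>, the total is at most
        \<open>2 ^ (3 * q j0 + 1)\<close>, which is within the gap \<open>32 ^ q j0\<close> supplied
        by sparsity.\<close>
      have "k * (2 ^ Suc (q j0) * 2 ^ m) * 4 ^ p = (k * 4 ^ p) * (2 ^ Suc (q j0) * 2 ^ m)"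
        by simp
      also have "\<dots> \<le> 2 ^ q j0 * (2 ^ Suc (q j0) * 2 ^ q j0)"
      proof (intro mult_mono order.refl power_increasing)
        have "k * 4 ^ p \<le> q j0"
          using k(3) mq unfolding m_def by simp
        then show "k * 4 ^ p \<le> 2 ^ q j0"
          using less_exp[of "q j0"] by linarith
      qed (use mq in auto)
      also have "\<dots> = 2 ^ (q j0 + (Suc (q j0) + q j0))"
        by (simp only: power_add)
      also have "\<dots> \<le> 2 ^ (5 * q j0)"
        using mq by (intro power_increasing) auto
      also have "\<dots> = 32 ^ q j0"
        by (simp add: power_mult)
      also have "\<dots> < Min (Z j0)"
        using q[OF j0(1)] by blast
      finally have "k * (2 ^ Suc (q j0) * 2 ^ m) * 4 ^ p < Min (Z j0)" .
      moreover have "0 < k * (2 ^ Suc (q j0) * 2 ^ m)" "Z j0 \<in> large \<theta> s"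
        using k(1) Z(1) j0(1) by (simp, blast)
      ultimately obtain H0 where H0: "H0 \<subseteq> Z j0" "H0 \<in> \<L> p" "\<forall>x\<in>H0. \<forall>y\<in>H0. C x = C y"
        using splitsD[OF sp _ sparse_subset[OF spB neZ(3)[OF j0(1)]] _ card] by blast
      have C: "c x = c y" "\<forall>v\<le>q j0. R v x = R v y"
          "\<forall>i. j0 < i \<and> i < m \<longrightarrow> (\<exists>w\<in>H i. R x w) = (\<exists>w\<in>H i. R y w)"
        if "x \<in> H0" "y \<in> H0" for x y
      proof -
        have e: "C x = C y"
          using that H0(3) by blast
        show "c x = c y"
          using e unfolding C_def by simp
        show "\<forall>v\<le>q j0. R v x = R v y"
          using e unfolding C_def by blast
        show "\<forall>i. j0 < i \<and> i < m \<longrightarrow> (\<exists>w\<in>H i. R x w) = (\<exists>w\<in>H i. R y w)"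
          using e unfolding C_def by blast
      qed
      define H' where "H' = H(j0 := H0)"
      have H': "H' j0 = H0" "\<And>i. j0 < i \<Longrightarrow> H' i = H i"
        unfolding H'_def by auto
      have "P H' j0"
      proof (rule PI)
        fix x y assume "x \<in> H' j0" "y \<in> H' j0"
        then have xy: "x \<in> H0" "y \<in> H0"
          unfolding H'(1) .
        show "c x = c y" "\<And>v. v \<le> q j0 \<Longrightarrow> R v x = R v y"
          using C(1,2)[OF xy] by blast+
        show "(\<exists>w\<in>H' i. R x w) = (\<exists>w\<in>H' i. R y w)" if "j0 < i" "i < m" for i
          using C(3)[OF xy] that unfolding H'(2)[OF that(1)] by blast
      qed (use H0(1,2) H'(1) in simp_all)
      moreover have "P H' j" if j: "Suc j0 \<le> j" "j < m" for j
      proof -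
        have "P H j"
          using H j by blast
        note PD = PD[OF this]
        have eq: "H' j = H j"
          using H'(2) j(1) by simp
        show ?thesis
        proof (rule PI)
          fix x y assume "x \<in> H' j" "y \<in> H' j"
          then have xy: "x \<in> H j" "y \<in> H j"
            unfolding eq .
          show "c x = c y" "\<And>v. v \<le> q j \<Longrightarrow> R v x = R v y"
            using PD(3,4)[OF xy] by blast+
          show "(\<exists>w\<in>H' i. R x w) = (\<exists>w\<in>H' i. R y w)" if "j < i" "i < m" for i
          proof -
            have "H' i = H i"
              using H'(2) j(1) that(1) by simp
            then show ?thesis
              using PD(5)[OF xy that] by simp
          qed
        qed (use PD(1,2) eq in simp_all)
      qed
      ultimately have "P H' j" if "m - Suc r \<le> j" "j < m" for j
        using that unfolding j0_def[symmetric] by (metis le_eq_less_or_eq Suc_leI)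
      then show ?case
        by blast
    qed
    from this[of m] obtain H where "\<forall>j<m. P H j"
      by auto
    then have PH: "P H j" if "j < m" for j
      using that by blast
    note H1 = PD(1,2)[OF PH] and H2 = PD(3)[OF PH] and H3 = PD(4)[OF PH] and H4 = PD(5)[OF PH]
    have neH: "H j \<noteq> {}" if "j < m" for j
      using H1(2)[OF that] ne False by auto
    have HB: "H j \<subseteq> B" if "j < m" for j
      using H1(1)[OF that] neZ(3)[OF that] by blast
    define e where "e = (\<lambda>i j. \<exists>x\<in>H i. \<exists>y\<in>H j. R x y)"
    have e: "R x y = e i j" if "i < j" "j < m" "x \<in> H i" "y \<in> H j" for i j x y
    proof -
      have i: "i < m"
        using that by simp
      \<comment> \<open>By \<open>below\<close>, \<open>x'\<close> is at most \<open>q j\<close>, so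
        \<open>H3\<close> makes the colour independent of \<open>y'\<close>; afterwards
        \<open>H4\<close> makes it independent of \<open>x'\<close>.\<close>
      have *: "R x' y' = (\<exists>w\<in>H j. R x' w)" if "x' \<in> H i" "y' \<in> H j" for x' y'
        using H3[OF \<open>j < m\<close>] below[OF \<open>i < j\<close> \<open>j < m\<close>] H1(1)[OF i] that by blast
      show ?thesis
        unfolding e_def using * H4[OF i _ _ that(1,2)] that(3,4) by blast
    qed
    define b where "b = (\<lambda>j. c (Min (H j)))"
    have bB: "b j \<in> c ` B" and b: "\<And>x. x \<in> H j \<Longrightarrow> c x = b j" if j: "j < m" for j
    proof -
      have Min: "Min (H j) \<in> H j"
        using Min_in[OF finite_subset[OF HB[OF j] fin(1)] neH[OF j]] .
      then show "b j \<in> c ` B"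
        using HB[OF j] unfolding b_def by blast
      show "c x = b j" if "x \<in> H j" for x
        unfolding b_def using H2[OF j that Min] .
    qed
    \<comment> \<open>Pigeonhole on more than \<open>k * 4 ^ p\<close> blocks: some value of
      \<open>c\<close> is shared by \<open>4 ^ p\<close> of them, enough for Ramsey's theorem to
      select \<open>p\<close> blocks with one colour between them.\<close>
    have "\<exists>a \<in> c ` B. 4 ^ p \<le> card {j. j < m \<and> b j = a}"
    proof (rule ccontr)
      assume neg: "\<not> ?thesis"
      have "m = card (\<Union>a\<in>c ` B. {j. j < m \<and> b j = a})"
      proof -
        have "(\<Union>a\<in>c ` B. {j. j < m \<and> b j = a}) = {..<m}"
          using bB by auto
        then show ?thesis
          by simp
      qed
      also have "\<dots> \<le> (\<Sum>a\<in>c ` B. card {j. j < m \<and> b j = a})"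
        using fin(1) by (intro card_UN_le) auto
      also have "\<dots> \<le> (\<Sum>a\<in>c ` B. 4 ^ p)"
        using neg by (intro sum_mono) auto
      also have "\<dots> \<le> k * 4 ^ p"
        using k(2) by simp
      finally show False
        using k(3) unfolding m_def by simp
    qed
    then obtain a where a: "4 ^ p \<le> card {j. j < m \<and> b j = a}"
      by blast
    have "(2::nat) ^ (p + p) = 4 ^ p"
      by (simp add: mult_2[symmetric] power_mult)
    then obtain c' J where J: "J \<subseteq> {j. j < m \<and> b j = a}" "card J = p"
      "\<forall>i\<in>J. \<forall>j\<in>J. i < j \<longrightarrow> e i j = c'"
      using ramsey_pairs[of "{j. j < m \<and> b j = a}" "\<lambda>_. p" e] a by auto
    have "finite J"
      using J(1) by (rule finite_subset) simp
    then obtain h where h: "\<forall>i<p. h i \<in> J" "\<forall>i j. i < j \<and> j < p \<longrightarrow> h i < h j"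
      using strict_mono_enumeration J(2) by metis
    have hm: "h i < m" "b (h i) = a" if "i < p" for i
      using h(1) J(1) that by auto
    define F where "F = (\<Union>i<p. H (h i))"
    have FB: "F \<subseteq> B"
      unfolding F_def using HB hm by blast
    have "F \<in> cmult c' (\<L> p) p"
    proof (rule cmultI)
      show "finite F"
        using finite_subset[OF FB fin(1)] .
      show "H (h i) \<in> \<L> p" "H (h i) \<subseteq> F" if "i < p" for i
        using H1(2)[OF hm(1)[OF that]] that unfolding F_def by (simp, blast)
      fix i j assume "i < j" "j < p"
      then have ij: "h i < h j" "h i < m" "h j < m" "h i \<in> J" "h j \<in> J"
        using h hm by auto
      show "apart \<theta> (H (h i)) (H (h j))"
      proof (rule apart_subset)
        show "apart \<theta> (Z (h i)) (Z (h j))"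
          using Z(2) ij by blast
      qed (use ij H1 neH neZ in auto)
      show "R x y = c'" if "x \<in> H (h i)" "y \<in> H (h j)" for x y
        using e[OF ij(1,3) that] J(3) ij by blast
    qed
    then have "F \<in> gmult (\<L> p) p"
      unfolding gmult_def by blast
    moreover have "c x = a" if xF: "x \<in> F" for x
    proof -
      obtain i where i: "i < p" "x \<in> H (h i)"
        using xF unfolding F_def by blast
      then show ?thesis
        using b[OF hm(1)] hm(2) by simp
    qed
    ultimately show ?thesis
      using FB by metis
  qed
qed

text \<open>One exponent per branching level, by \<open>splits_gmult\<close>; its nonemptiness
  condition holds because positive branching leads to a nonempty leaf.\<close>

lemma splits_gnest:
  assumes "splits s (\<lambda>_. glarge n)"
  shows "splits (s + d) (\<lambda>p. gnest p d (glarge n))"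
proof (induction d)
  case 0
  then show ?case
    using assms by simp
next
  case (Suc d)
  have "{} \<notin> gnest p d (glarge n)" if "0 < p" for p
    using gnest_leaf[of "{}" p d "glarge n"] that glarge_finite_nonempty by blast
  then show ?case
    using splits_gmult[OF Suc] unfolding gnest_Suc by simp
qed

text \<open>One exponent yields \<open>Min B\<close> blocks, and \<open>n + 1\<close> more put a
  nest of \<open>n + 1\<close> levels into each. Two blocks share the value of \<open>c\<close>; the
  root comes from the earlier and its nest from the later one.\<close>

lemma splits_glarge_Suc:
  assumes sp0: "splits s (\<lambda>_. glarge n)"
  shows "splits (s + n + 2) (\<lambda>_. glarge (Suc n))"
  unfolding splits_def
proof (intro allI impI)
  fix B k and p :: nat and c :: "nat \<Rightarrow> nat"
  assume "B \<in> large \<theta> (s + n + 2)" and spB: "sparse (\<lambda>x. 32 ^ x) B"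
    and k: "0 < k" "card (c ` B) \<le> k" "k * 4 ^ p < Min B"
  then have B: "B \<in> large \<theta> (Suc (s + Suc n))"
    by simp
  note sp = splits_gnest[OF sp0, of "Suc n"]
  define m where "m = Min B"
  have fin: "finite B" "B \<noteq> {}"
    using B large_finite_nonempty by auto
  have "k \<le> k * 4 ^ p"
    by simp
  then have km: "k < m"
    using k(3) unfolding m_def by (rule le_less_trans)
  have "0 \<notin> B"
    using k(3) fin(1) by (metis Min_le less_nat_zero_code less_le_trans)
  then obtain Z where Z: "\<forall>i<m. Z i \<in> large \<theta> (s + Suc n) \<and> Z i \<subseteq> B - {m}"
    "\<forall>i j. i < j \<and> j < m \<longrightarrow> apart \<theta> (Z i) (Z j)"
    using large_blocks[OF B] unfolding m_def by blast
  have neZ: "finite (Z i)" "Z i \<noteq> {}" "Z i \<subseteq> B" if "i < m" for i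
    using Z(1) that large_finite_nonempty by blast+
  \<comment> \<open>The nest gets width \<open>q\<close>, a bound for all elements of
    \<open>B\<close> below the block. Any earlier point can then be its root: the branching suffices
    and the colour towards \<open>H\<close> is constant.\<close>
  define P where "P = (\<lambda>i q H. m \<le> q \<and> (\<forall>b\<in>B. b < Min (Z i) \<longrightarrow> b \<le> q) \<and> H \<subseteq> Z i \<and>
      H \<in> gnest q (Suc n) (glarge n) \<and>
      (\<forall>x\<in>H. \<forall>y\<in>H. c x = c y \<and> (\<forall>v\<le>q. R v x = R v y)))"
  have "\<exists>q H. P i q H" if i: "i < m" for i
  proof -
    obtain q where q: "m \<le> q" "32 ^ q < Min (Z i)" "\<forall>b\<in>B. b < Min (Z i) \<longrightarrow> b \<le> q"
      using gap_below[OF spB fin(1)] Z(1) neZ(2) i unfolding m_def by metis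
    define C where "C = (\<lambda>u. (c u, {v. v \<le> q \<and> R v u}))"
    have "C ` Z i \<subseteq> c ` B \<times> Pow {..q}"
      unfolding C_def using neZ(3)[OF i] by auto
    then have "card (C ` Z i) \<le> card (c ` B \<times> Pow {..q})"
      using fin(1) by (intro card_mono) auto
    also have "\<dots> = card (c ` B) * 2 ^ Suc q"
      by (simp add: card_cartesian_product card_Pow)
    also have "\<dots> \<le> k * 2 ^ Suc q"
      using k(2) by simp
    finally have card: "card (C ` Z i) \<le> k * 2 ^ Suc q" .
    have "k \<le> 2 ^ q"
      using km q(1) less_exp[of q] by linarith
    \<comment> \<open>The base 32 comes from here: the width \<open>q\<close> contributes
      \<open>4 ^ q\<close>, and the total \<open>2 ^ (4 * q + 1)\<close> is at most
      \<open>2 ^ (5 * q)\<close> since \<open>q\<close> is positive.\<close>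
    then have "k * 2 ^ Suc q * 4 ^ q \<le> 2 ^ q * 2 ^ Suc q * 4 ^ q"
      by (intro mult_mono order.refl) auto
    also have "\<dots> = 2 ^ (q + Suc q + 2 * q)"
      by (simp only: power_add) (simp add: power_mult)
    also have "\<dots> \<le> 2 ^ (5 * q)"
      using km q(1) by (intro power_increasing) auto
    also have "\<dots> = 32 ^ q"
      by (simp add: power_mult)
    finally have "k * 2 ^ Suc q * 4 ^ q < Min (Z i)"
      using q(2) by linarith
    moreover have "0 < k * 2 ^ Suc q" "Z i \<in> large \<theta> (s + Suc n)"
      using k(1) Z(1) i by (simp, blast)
    ultimately obtain H where H: "H \<subseteq> Z i" "H \<in> gnest q (Suc n) (glarge n)"
      "\<forall>x\<in>H. \<forall>y\<in>H. C x = C y"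
      using splitsD[OF sp _ sparse_subset[OF spB neZ(3)[OF i]] _ card] by blast
    have "\<forall>x\<in>H. \<forall>y\<in>H. c x = c y \<and> (\<forall>v\<le>q. R v x = R v y)"
      using H(3) unfolding C_def by blast
    then have "P i q H"
      unfolding P_def using H(1,2) q(1,3) by blast
    then show ?thesis
      by blast
  qed
  then obtain q H where P: "\<And>i. i < m \<Longrightarrow> P i (q i) (H i)"
    by metis
  have
    q: "\<And>i. i < m \<Longrightarrow> m \<le> q i" "\<And>i b. i < m \<Longrightarrow> b \<in> B \<Longrightarrow> b < Min (Z i) \<Longrightarrow> b \<le> q i" and
    H: "\<And>i. i < m \<Longrightarrow> H i \<subseteq> Z i" "\<And>i. i < m \<Longrightarrow> H i \<in> gnest (q i) (Suc n) (glarge n)" and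
    H2: "\<And>i x y. i < m \<Longrightarrow> x \<in> H i \<Longrightarrow> y \<in> H i \<Longrightarrow> c x = c y" and
    H3: "\<And>i x y v. i < m \<Longrightarrow> x \<in> H i \<Longrightarrow> y \<in> H i \<Longrightarrow> v \<le> q i \<Longrightarrow> R v x = R v y"
    using P unfolding P_def by blast+
  have MinH: "Min (H i) \<in> H i" if "i < m" for i
  proof -
    have "0 < q i"
      using q(1)[OF that] that by simp
    then have "H i \<noteq> {}"
      using gnest_leaf[OF H(2)[OF that]] glarge_finite_nonempty by blast
    then show ?thesis
      using gnest_finite[OF H(2)[OF that]] by simp
  qed
  have HB: "H i \<subseteq> B" if "i < m" for i
    using H(1)[OF that] neZ(3)[OF that] by blast
  define b where "b = (\<lambda>i. c (Min (H i)))"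
  have "b ` {..<m} \<subseteq> c ` B"
    unfolding b_def using MinH HB by blast
  then have "card (b ` {..<m}) \<le> k"
    using k(2) fin(1) by (meson card_mono finite_imageI order_trans)
  \<comment> \<open>There are \<open>m > k\<close> blocks and at most \<open>k\<close> values of
    \<open>c\<close>, so two blocks agree.\<close>
  then have "\<not> inj_on b {..<m}"
    using km by (metis card_image card_lessThan not_le)
  then obtain i j where ij: "i < j" "j < m" "b i = b j"
    unfolding inj_on_def by (metis lessThan_iff linorder_neqE_nat)
  define x where "x = Min (H i)"
  have xH: "x \<in> H i"
    unfolding x_def using MinH ij by simp
  have xB: "x \<in> B" and xZ: "\<forall>y\<in>Z j. x < y"
    using xH H(1)[of i] HB[of i] ij Z(2) apart_less by (auto, blast)
  have xq: "x \<le> q j"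
    using q(2)[OF ij(2) xB] xZ neZ[OF ij(2)] by (metis Min_in)
  define F where "F = insert x (H j)"
  have HZ: "H j \<subseteq> Z j" and Hq: "H j \<in> gnest x (Suc n) (glarge n)"
    using H[OF ij(2)] gnest_antimono[OF xq] by blast+
  have "\<forall>y\<in>H j. x < y \<and> R x y = R x (Min (H j))"
    using xZ HZ H3[OF ij(2) _ MinH[OF ij(2)] xq] by blast
  moreover have "finite F" "x \<in> F" "H j \<subseteq> F"
    unfolding F_def using gnest_finite[OF Hq] by auto
  ultimately have "F \<in> glarge (Suc n)"
    using Hq unfolding glarge.simps by blast
  moreover have "F \<subseteq> B"
    unfolding F_def using xB HB ij by blast
  moreover have "c y = b j" if "y \<in> F" for y
    using that ij(3) H2[OF ij(2) _ MinH[OF ij(2)]] unfolding F_def b_def x_def by auto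
  ultimately show "\<exists>H \<subseteq> B. H \<in> glarge (Suc n) \<and> (\<forall>x\<in>H. \<forall>y\<in>H. c x = c y)"
    by metis
qed

text \<open>Accumulated cost of \<open>splits_glarge_Suc\<close>; the closed form below is doubled
  to avoid a division.\<close>

primrec grouping_exponent :: "nat \<Rightarrow> nat" where
  "grouping_exponent 0 = 0"
| "grouping_exponent (Suc n) = grouping_exponent n + n + 2"

lemma grouping_exponent_closed: "2 * grouping_exponent n = n * (n + 3)"
  by (induction n) (simp_all add: algebra_simps)

lemma splits_glarge: "splits (grouping_exponent n) (\<lambda>_. glarge n)"
proof (induction n)
  case 0
  have "\<exists>H \<subseteq> B. H \<in> glarge 0 \<and> (\<forall>x\<in>H. \<forall>y\<in>H. c x = c y)" if B: "B \<in> large \<theta> 0"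
    for B and c :: "nat \<Rightarrow> nat"
  proof -
    obtain x where "x \<in> B"
      using B by auto
    then show ?thesis
      by (intro exI[of _ "{x}"]) auto
  qed
  then show ?case
    unfolding splits_def by simp
next
  case (Suc n)
  then show ?case
    using splits_glarge_Suc by simp
qed

text \<open>An instance of \<open>splits\<close> with one dummy colour and \<open>p = 0\<close>,
  whence the requirement \<open>1 < Min X\<close>.\<close>

lemma glarge_subset:
  assumes "X \<in> large \<theta> (grouping_exponent n)" "sparse (\<lambda>x. 32 ^ x) X" "2 \<le> Min X"
  shows "\<exists>H \<subseteq> X. H \<in> glarge n"
proof -
  have "card ((\<lambda>_. ()) ` X) \<le> 1"
    by (rule order_trans[OF card_mono[of "{()}"]]) auto
  then show ?thesis
    using splitsD[OF splits_glarge assms(1,2), of 1 "\<lambda>_. ()" 0] assms(3) by auto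
qed

subsection \<open>Homogeneous subsets of grouped large sets\<close>

definition hom :: "bool \<Rightarrow> nat set \<Rightarrow> bool" where
  "hom c H \<longleftrightarrow> (\<forall>x\<in>H. \<forall>y\<in>H. x < y \<longrightarrow> R x y = c)"

text \<open>A Ramsey argument on trees, by induction on the levels. If the top node has colour
  \<open>c\<close>, either some child already contains the nest of the other colour, or all children
  have nests of colour \<open>c\<close> with one level less, which the node joins. Depth 0 is met by
  a leaf.\<close>

lemma gnest_cnest:
  fixes d :: "bool \<Rightarrow> nat"
  assumes "upclosed L" "\<forall>A\<in>L. finite A" "0 < w" "F \<in> gnest w e L" "d True + d False \<le> Suc e"
  shows "\<exists>c. F \<in> cnest c w (d c) L"
  using assms(4,5)
proof (induction e arbitrary: F d)
  case 0
  then have "d True = 0 \<or> d False = 0"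
    by linarith
  then show ?case
    using 0 by (metis cnest_0 gnest_0)
next
  case (Suc e)
  show ?case
  proof (cases "\<exists>c. d c = 0")
    case True
    then obtain c where c: "d c = 0"
      by blast
    obtain E where "E \<subseteq> F" "E \<in> L"
      using gnest_leaf[OF Suc.prems(1) assms(3)] by blast
    moreover have "finite F"
      using Suc.prems(1) unfolding gnest_Suc gmult_def cmult_def by blast
    ultimately have "F \<in> L"
      using assms(1) upclosedD by blast
    then show ?thesis
      using c by (metis cnest_0)
  next
    case False
    then have pos: "0 < d c" for c
      by simp
    obtain c where "F \<in> cmult c (gnest w e L) w"
      using Suc.prems(1) unfolding gnest_Suc gmult_def by blast
    then obtain X where X': "finite F" "\<forall>i<w. X i \<in> gnest w e L \<and> X i \<subseteq> F"
      "\<forall>i j. i < j \<and> j < w \<longrightarrow> apart \<theta> (X i) (X j) \<and> (\<forall>x\<in>X i. \<forall>y\<in>X j. R x y = c)"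
      unfolding cmult_def by auto
    have X: "finite F"
      "\<And>i. i < w \<Longrightarrow> X i \<in> gnest w e L"
      "\<And>i. i < w \<Longrightarrow> X i \<subseteq> F"
      "\<And>i j. i < j \<Longrightarrow> j < w \<Longrightarrow> apart \<theta> (X i) (X j)"
      "\<And>i j x y. i < j \<Longrightarrow> j < w \<Longrightarrow> x \<in> X i \<Longrightarrow> y \<in> X j \<Longrightarrow> R x y = c"
      using X' by auto
    define d' where "d' = d(c := d c - 1)"
    have "d' True + d' False \<le> Suc e"
      using Suc.prems(2) pos[of True] pos[of False] unfolding d'_def by (cases c) auto
    then have IH: "\<exists>c'. X i \<in> cnest c' w (d' c') L" if "i < w" for i
      using Suc.IH[OF X(2)] that by blast
    show ?thesis
    proof (cases "\<exists>i<w. X i \<in> cnest (\<not> c) w (d (\<not> c)) L")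
      case True
      then obtain i where i: "i < w" "X i \<in> cnest (\<not> c) w (d (\<not> c)) L"
        by blast
      obtain d0 where d0: "d (\<not> c) = Suc d0"
        using False not0_implies_Suc by blast
      have "F \<in> cnest (\<not> c) w (d (\<not> c)) L"
        using i(2) unfolding d0 cnest_Suc
        by (rule upclosedD[OF upclosed_cmult _ X(3)[OF i(1)] X(1)])
      then show ?thesis
        by blast
    next
      case no: False
      have "X i \<in> cnest c w (d c - 1) L" if i: "i < w" for i
      proof -
        obtain c' where c': "X i \<in> cnest c' w (d' c') L"
          using IH[OF i] by blast
        have "c' = c"
        proof (rule ccontr)
          assume "c' \<noteq> c"
          then have "c' = (\<not> c)"
            by blast
          then have "X i \<in> cnest (\<not> c) w (d (\<not> c)) L"
            using c' unfolding d'_def by simp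
          then show False
            using no i by blast
        qed
        then show ?thesis
          using c' unfolding d'_def by simp
      qed
      then have "F \<in> cmult c (cnest c w (d c - 1) L) w"
        using X by (intro cmultI[of F w X])
      then have "F \<in> cnest c w (d c) L"
        using False by (metis Suc_diff_1 cnest_Suc gr0I)
      then show ?thesis
        by blast
    qed
  qed
qed

text \<open>Each leaf is replaced by a homogeneous subset; pairs in different blocks have colour
  \<open>c\<close> by the nest.\<close>

lemma cnest_hom:
  assumes leaf: "\<And>A. A \<in> L \<Longrightarrow> A \<subseteq> X \<Longrightarrow> \<exists>H \<subseteq> A. hom c H \<and> H \<in> large \<theta> n"
    and "F \<in> cnest c w d L" "F \<subseteq> X" "finite X" "0 < w"
  shows "\<exists>H \<subseteq> F. hom c H \<and> H \<in> nest \<theta> w d (large \<theta> n)"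
  using assms(2,3)
proof (induction d arbitrary: F)
  case 0
  then show ?case
    using leaf by simp
next
  case (Suc d)
  have "F \<in> cmult c (cnest c w d L) w"
    using Suc.prems(1) unfolding cnest_Suc .
  then obtain Y where Y': "finite F" "\<forall>i<w. Y i \<in> cnest c w d L \<and> Y i \<subseteq> F"
      "\<forall>i j. i < j \<and> j < w \<longrightarrow> apart \<theta> (Y i) (Y j) \<and> (\<forall>x\<in>Y i. \<forall>y\<in>Y j. R x y = c)"
    unfolding cmult_def by auto
  have Y: "finite F"
    "\<And>i. i < w \<Longrightarrow> Y i \<in> cnest c w d L"
    "\<And>i. i < w \<Longrightarrow> Y i \<subseteq> F"
    "\<And>i j. i < j \<Longrightarrow> j < w \<Longrightarrow> apart \<theta> (Y i) (Y j)"
    "\<And>i j x y. i < j \<Longrightarrow> j < w \<Longrightarrow> x \<in> Y i \<Longrightarrow> y \<in> Y j \<Longrightarrow> R x y = c"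
    using Y' by auto
  have "\<exists>H. i < w \<longrightarrow> H \<subseteq> Y i \<and> hom c H \<and> H \<in> nest \<theta> w d (large \<theta> n)" for i
    using Suc.IH[OF Y(2) subset_trans[OF Y(3) Suc.prems(2)]] by blast
  then obtain H where H: "\<And>i. i < w \<Longrightarrow> H i \<subseteq> Y i \<and> hom c (H i) \<and> H i \<in> nest \<theta> w d (large \<theta> n)"
    by metis
  have ne: "H i \<noteq> {}" "finite (Y i)" if "i < w" for i
  proof -
    show "H i \<noteq> {}"
      using H[OF that] nest_leaf[of "H i" \<theta> w d] large_finite_nonempty assms(5) by blast
    show "finite (Y i)"
      using finite_subset[OF Y(3)[OF that] Y(1)] .
  qed
  \<comment> \<open>Only the chosen parts are kept, since \<open>F\<close> may have further points
    whose colours are not controlled.\<close>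
  define U where "U = (\<Union>i<w. H i)"
  have UF: "U \<subseteq> F"
    unfolding U_def using H Y(3) by blast
  have "hom c U"
    unfolding hom_def
  proof (intro ballI impI)
    fix x y assume "x \<in> U" "y \<in> U" and xy: "x < y"
    then obtain i j where ij: "i < w" "x \<in> H i" "j < w" "y \<in> H j"
      unfolding U_def by blast
    then have Yij: "x \<in> Y i" "y \<in> Y j"
      using H by blast+
    consider "i = j" | "i < j" | "j < i"
      by linarith
    then show "R x y = c"
    proof cases
      case 1
      then show ?thesis
        using H ij xy unfolding hom_def by blast
    next
      case 2
      then show ?thesis
        using Y(5) ij Yij by blast
    next
      case 3
      then have "y < x"
        using apart_less[OF Y(4)] ij Yij by blast
      then show ?thesis
        using xy by simp
    qed
  qed
  moreover have "U \<in> nest \<theta> w (Suc d) (large \<theta> n)"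
    unfolding nest_Suc
  proof (rule fam_multI)
    show "finite U"
      using finite_subset[OF UF Y(1)] .
    show "H i \<in> nest \<theta> w d (large \<theta> n)" "H i \<subseteq> U" if "i < w" for i
      using H[OF that] that unfolding U_def by blast+
    fix i j assume ij: "i < j" "j < w"
    then have i: "i < w"
      by simp
    have "H i \<subseteq> Y i" "H j \<subseteq> Y j"
      using H[OF i] H[OF ij(2)] by blast+
    then show "apart \<theta> (H i) (H j)"
      using apart_subset[OF Y(4)[OF ij] _ _ ne(1)[OF i] ne(1)[OF ij(2)] ne(2)[OF i] ne(2)[OF ij(2)]]
      by blast
  qed
  ultimately show ?case
    using UF by blast
qed

text \<open>Here \<open>x\<close> supplies its own colour \<open>c0\<close> towards everything. If the nest of \<open>x\<close> has no node of the
  opposite colour, it suffices by itself; otherwise such a node has blocks \<open>B0\<close>, \<open>B1\<close>, any \<open>y\<close> in \<open>B0\<close>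
  supplies the opposite colour towards \<open>B1\<close>, and a nest inside \<open>B1\<close>, which is wider than both
  \<open>x\<close> and \<open>y\<close>, can be completed whatever its colour.\<close>

lemma glarge_hom:
  fixes s :: "bool \<Rightarrow> nat"
  assumes "X \<in> glarge (2 * (s True + s False))" "\<forall>x\<in>X. 2 \<le> x"
  shows "\<exists>c. \<exists>H \<subseteq> X. hom c H \<and> H \<in> large \<theta> (s c)"
  using assms
proof (induction "s True + s False" arbitrary: s X rule: less_induct)
  case less
  have fin: "finite X" "X \<noteq> {}"
    using less.prems(1) glarge_finite_nonempty by blast+
  have no0: "0 \<notin> X"
    using less.prems(2) by fastforce
  show ?case
  proof (rule ccontr)
    assume neg: "\<not> ?thesis"
    \<comment> \<open>A target 0 is met by any singleton.\<close>
    have pos: "0 < s c" for c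
    proof (rule ccontr)
      assume "\<not> 0 < s c"
      moreover obtain x where "x \<in> X"
        using fin by blast
      ultimately have "{x} \<subseteq> X" "hom c {x}" "{x} \<in> large \<theta> (s c)"
        unfolding hom_def by auto
      then show False
        using neg by blast
    qed
    \<comment> \<open>Lowering one target by one lowers the exponent by two, so the induction
      hypothesis applies at exponent \<open>N\<close>.\<close>
    define N where "N = 2 * (s True + s False) - 2"
    have N: "2 * (s True + s False) = Suc (Suc N)"
      unfolding N_def using pos[of True] pos[of False] by simp
    \<comment> \<open>With the target of \<open>c\<close> lowered, the hypothesis cannot return the
      other colour, as \<open>neg\<close> forbids it; hence both colours are available inside every
      such \<open>A\<close>.\<close>
    have leaf: "\<exists>H \<subseteq> A. hom c H \<and> H \<in> large \<theta> (s c - 1)" if "A \<in> glarge N" "A \<subseteq> X" for A c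
    proof -
      define s' where "s' = s(c := s c - 1)"
      have s': "s' True + s' False < s True + s False" "N = 2 * (s' True + s' False)"
        unfolding s'_def N_def using pos[of True] pos[of False] by (cases c; auto)+
      have "A \<in> glarge (2 * (s' True + s' False))" "\<forall>x\<in>A. 2 \<le> x"
        using that s'(2) less.prems(2) by auto
      then obtain c' H where H: "H \<subseteq> A" "hom c' H" "H \<in> large \<theta> (s' c')"
        using less.hyps[OF s'(1)] by blast
      have "c' = c"
      proof (rule ccontr)
        assume "c' \<noteq> c"
        then have "H \<in> large \<theta> (s c')"
          using H(3) unfolding s'_def by simp
        then show False
          using neg H that by blast
      qed
      then show ?thesis
        using H unfolding s'_def by auto
    qed
    have leaf': "\<exists>H \<subseteq> A. hom c H \<and> H \<in> large \<theta> (s c - 1)" if "A \<in> glarge (Suc N)" "A \<subseteq> X" for A c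
      using leaf[OF glarge_SucD[OF that(1)]] no0 that by blast
    \<comment> \<open>A root \<open>u\<close> joined in colour \<open>c\<close> to a uniform nest of
      colour \<open>c\<close>, depth \<open>s c\<close> and width at least \<open>u\<close> would
      reach exponent \<open>s c\<close> once its leaves are made homogeneous.\<close>
    have complete: False if "u \<in> X" "\<forall>v\<in>F. u < v \<and> R u v = c" "F \<subseteq> X" "0 < w" "u \<le> w"
        "F \<in> cnest c w (s c) (glarge M)" "M = N \<or> M = Suc N" for u F c w M
    proof -
      have "\<exists>H \<subseteq> F. hom c H \<and> H \<in> nest \<theta> w (s c) (large \<theta> (s c - 1))"
        using that(3,4,6,7) leaf leaf' fin(1) by (intro cnest_hom[of "glarge M" X]) auto
      then obtain H where H: "H \<subseteq> F" "hom c H" "H \<in> nest \<theta> w (s c) (large \<theta> (s c - 1))"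
        by blast
      then have "H \<in> nest \<theta> u (Suc (s c - 1)) (large \<theta> (s c - 1))"
        using subsetD[OF nest_antimono[OF that(5)] H(3)] pos[of c] by simp
      then have "insert u H \<in> large \<theta> (Suc (s c - 1))"
        using H(1) that(2,3) fin(1) by (intro large_SucI[of _ u H]) (auto intro: finite_subset)
      then have "insert u H \<in> large \<theta> (s c)"
        using pos[of c] by simp
      moreover have "hom c (insert u H)"
        using H(1,2) that(2) unfolding hom_def by (metis insertE less_asym less_irrefl subsetD)
      moreover have "insert u H \<subseteq> X"
        using H(1) that(1,3) by blast
      ultimately show False
        using neg by blast
    qed
    obtain x c0 Y where x: "x \<in> X" "Y \<subseteq> X" "\<forall>y\<in>Y. x < y \<and> R x y = c0"
      "Y \<in> gnest x (Suc (Suc N)) (glarge (Suc N))"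
      using less.prems(1) unfolding N glarge.simps by blast
    have x2: "2 \<le> x"
      using x(1) less.prems(2) by blast
    \<comment> \<open>Depth \<open>s c0\<close> in the colour of the root is what
      \<open>complete\<close> needs; in the other colour a single node is asked for.\<close>
    define d where "d = (\<lambda>c. if c = c0 then s c0 else 1)"
    have "d True + d False \<le> Suc (Suc (Suc N))"
      unfolding d_def using N pos[of True] pos[of False] by (cases c0) auto
    then obtain c1 where c1: "Y \<in> cnest c1 x (d c1) (glarge (Suc N))"
      using gnest_cnest[OF upclosed_glarge _ _ x(4), of d] glarge_finite_nonempty x2 by auto
    have "c1 \<noteq> c0"
    proof
      assume "c1 = c0"
      then have "Y \<in> cnest c0 x (s c0) (glarge (Suc N))"
        using c1 unfolding d_def by simp
      moreover have "0 < x"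
        using x2 by simp
      ultimately show False
        using complete[OF x(1,3,2) _ order.refl] by blast
    qed
    then have "Y \<in> cmult (\<not> c0) (glarge (Suc N)) x"
      using c1 cnest_Suc[of c1 x 0] unfolding d_def by (cases c0; cases c1) auto
    then obtain B where B': "\<forall>i<x. B i \<in> glarge (Suc N) \<and> B i \<subseteq> Y"
      "\<forall>i j. i < j \<and> j < x \<longrightarrow> apart \<theta> (B i) (B j) \<and> (\<forall>x\<in>B i. \<forall>y\<in>B j. R x y = (\<not> c0))"
      unfolding cmult_def by auto
    have B: "\<And>i. i < x \<Longrightarrow> B i \<in> glarge (Suc N)"
      "\<And>i. i < x \<Longrightarrow> B i \<subseteq> Y"
      "\<And>i j. i < j \<Longrightarrow> j < x \<Longrightarrow> apart \<theta> (B i) (B j)"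
      "\<And>i j u v. i < j \<Longrightarrow> j < x \<Longrightarrow> u \<in> B i \<Longrightarrow> v \<in> B j \<Longrightarrow> R u v = (\<not> c0)"
      using B' by auto
    \<comment> \<open>Two blocks are available because \<open>x \<ge> 2\<close>.\<close>
    have B01: "B 0 \<in> glarge (Suc N)" "B 1 \<in> glarge (Suc N)" "B 0 \<subseteq> Y" "B 1 \<subseteq> Y"
        "apart \<theta> (B 0) (B 1)" "\<forall>u\<in>B 0. \<forall>v\<in>B 1. R u v = (\<not> c0)"
      using B[of 0] B(1,2)[of 1] B(3,4)[of 0 1] x2 by auto
    obtain y where y: "y \<in> B 0"
      using B01(1) glarge_finite_nonempty by blast
    obtain z Z where z: "z \<in> B 1" "Z \<subseteq> B 1" "Z \<in> gnest z (Suc N) (glarge N)"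
      using B01(2) unfolding glarge.simps by blast
    have xz: "x \<le> z" "y \<le> z" "0 < z"
      using x(3) B01(4) z(1) x2 apart_less[OF B01(5) y z(1)] by fastforce+
    \<comment> \<open>\<open>Z\<close> has \<open>N + 1\<close> levels, so
      \<open>gnest_cnest\<close> asks for a total depth of at most \<open>N + 2\<close>.\<close>
    have "s True + s False \<le> 2 * (s True + s False)"
      by simp
    then have "s True + s False \<le> Suc (Suc N)"
      by (simp only: N)
    then obtain c where c: "Z \<in> cnest c z (s c) (glarge N)"
      using gnest_cnest[OF upclosed_glarge _ xz(3) z(3), of s] glarge_finite_nonempty by auto
    have ZX: "Z \<subseteq> X"
      using z(2) B01(4) x(2) by blast
    show False
    proof (cases "c = c0")
      case True
      have "\<forall>v\<in>Z. x < v \<and> R x v = c"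
        using True x(3) z(2) B01(4) by blast
      then show False
        using complete[OF x(1) _ ZX xz(3,1) c] by blast
    next
      case False
      have "\<forall>v\<in>Z. y < v \<and> R y v = c"
        using False y B01(5,6) z(2) apart_less by blast
      moreover have "y \<in> X"
        using y B01(3) x(2) by blast
      ultimately show False
        using complete[OF _ _ ZX xz(3,2) c] by blast
    qed
  qed
qed

end

subsection \<open>The partition theorem\<close>

lemma prim_rec_add: "prim_rec k f \<Longrightarrow> prim_rec k (\<lambda>xs. j + f xs)"
proof (induction j)
  case (Suc j)
  then show ?case
    using prim_rec.comp[of "[\<lambda>xs. j + f xs]" "\<lambda>xs. Suc (xs ! 0)" k] prim_rec.succ by simp
qed simp

text \<open>Iterated addition of the fixed \<open>j\<close>: in \<open>y # r # tl xs\<close> the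
  entry with index 1 is the previous value \<open>r\<close>. The argument \<open>f\<close> is
  substituted by composition.\<close>

lemma prim_rec_mult: "prim_rec k f \<Longrightarrow> prim_rec k (\<lambda>xs. j * f xs)"
proof -
  assume f: "prim_rec k f"
  have "prim_rec (Suc 0) (\<lambda>xs. rec_nat 0 (\<lambda>y r. j + (y # r # tl xs) ! 1) (hd xs))"
    using prim_rec.prec[OF prim_rec.zero prim_rec_add[OF prim_rec.proj], of 1 0 j] by simp
  moreover have "rec_nat 0 (\<lambda>y r. j + (y # r # ys) ! 1) n = j * n" for n and ys :: "nat list"
    by (induction n) auto
  ultimately show ?thesis
    using prim_rec.comp[of "[f]" "\<lambda>xs. j * hd xs" k] f by simp
qed

lemma primitive_recursive_power: "primitive_recursive (\<lambda>x. b ^ x)"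
proof -
  have one: "prim_rec 0 (\<lambda>xs. 1)"
    using prim_rec_add[OF prim_rec.zero, of 0 1] by simp
  have "prim_rec (Suc 0) (\<lambda>xs. rec_nat 1 (\<lambda>y r. b * (y # r # tl xs) ! 1) (hd xs))"
    using prim_rec.prec[OF one prim_rec_mult[OF prim_rec.proj], of 1 b] by simp
  moreover have "rec_nat 1 (\<lambda>y r. b * (y # r # ys) ! 1) n = b ^ n" for n and ys :: "nat list"
    by (induction n) auto
  ultimately have "prim_rec 1 (\<lambda>xs. b ^ hd xs)"
    by simp
  then show ?thesis
    unfolding primitive_recursive_def by (intro exI[of _ "\<lambda>xs. b ^ hd xs"]) simp
qed

section \<open>Combination of grouping and homogenisation\<close>

lemma RT22_large_exponential:
  assumes X: "X \<in> large \<theta> (Suc s)" and s: "grouping_exponent (4 * n) \<le> s"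
    and sp: "sparse (\<lambda>x. 32 ^ x) X"
  shows "RT22_large \<theta> n X"
  unfolding RT22_large_def
proof (intro allI impI)
  fix f assume f: "f \<in> nsets X 2 \<rightarrow> {..<2::nat}"
  have fin: "finite X" "X \<noteq> {}"
    using X large_finite_nonempty by auto
  show "\<exists>H \<subseteq> X. homogeneous f H \<and> H \<in> large \<theta> n"
  proof (cases "0 \<in> X")
    case True
    \<comment> \<open>The minimum 0 demands no blocks, so a singleton is large for every exponent;
      its homogeneity is vacuous.\<close>
    have "{0} \<in> large \<theta> n"
    proof (cases n)
      case (Suc n')
      have "{} \<in> nest \<theta> 0 (Suc n') (large \<theta> n')"
        unfolding nest_Suc fam_mult_def by simp
      then show ?thesis
        unfolding Suc large_Suc by simp
    qed simp
    moreover have "homogeneous f {0}"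
      unfolding homogeneous_def nsets_def by (auto simp: subset_singleton_iff)
    ultimately show ?thesis
      using True by blast
  next
    case False
    define R where "R = (\<lambda>x y. f {x, y} = 0)"
    \<comment> \<open>One exponent pays for discarding \<open>Min X\<close>, which may be 1; all
      elements of \<open>Z\<close> are at least 2.\<close>
    obtain Z where Z: "Z \<subseteq> X - {Min X}" "Z \<in> large \<theta> s"
      using large_SucD[OF X False] by blast
    have "Min X \<noteq> 0"
      using False fin Min_in by metis
    have Z2: "\<forall>z\<in>Z. 2 \<le> z"
    proof
      fix z assume "z \<in> Z"
      then have "Min X < z"
        using Z(1) fin by (metis DiffD1 DiffD2 Min_le insertI1 le_neq_implies_less subsetD)
      then show "2 \<le> z"
        using \<open>Min X \<noteq> 0\<close> by linarith
    qed
    have "0 \<notin> Z"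
      using Z2 by fastforce
    then have "Z \<in> large \<theta> (grouping_exponent (4 * n))"
      using large_mono Z(2) s by blast
    moreover have "2 \<le> Min Z"
      using Z2 Z(2) large_finite_nonempty Min_in by metis
    moreover have "sparse (\<lambda>x. 32 ^ x) Z"
      using sp Z(1) unfolding sparse_def by blast
    ultimately obtain G where G: "G \<subseteq> Z" "G \<in> glarge \<theta> R (4 * n)"
      using glarge_subset by blast
    \<comment> \<open>The exponent \<open>4 * n\<close> corresponds to the target \<open>n\<close>
      for both colours.\<close>
    then have "G \<in> glarge \<theta> R (2 * (n + n))" "\<forall>x\<in>G. 2 \<le> x"
      using Z2 by auto
    then obtain c H where H: "H \<subseteq> G" "hom R c H" "H \<in> large \<theta> n"
      using glarge_hom[of G \<theta> R "\<lambda>_. n"] by blast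
    have HX: "H \<subseteq> X"
      using H(1) G(1) Z(1) by blast
    have "f e = (if c then 0 else 1)" if e: "e \<in> nsets H 2" for e
    proof -
      obtain x y where xy: "x < y" "e = {x, y}" "x \<in> H" "y \<in> H"
        using e by (auto elim!: nsets2_E) (metis insert_commute linorder_neqE_nat)
      have "R x y = c"
        using H(2) xy unfolding hom_def by blast
      moreover have "f e < 2"
        using f e HX nsets_mono by blast
      ultimately show ?thesis
        unfolding R_def xy(2) by auto
    qed
    then show ?thesis
      using HX H(3) unfolding homogeneous_def by blast
  qed
qed

theorem theorem3p31:
  fixes \<phi> :: delta00 and S :: "nat \<Rightarrow> nat set"
  assumes "scoped 3 \<phi>"
  shows "\<exists>g :: nat \<Rightarrow> nat. primitive_recursive g \<and>
    (\<forall>n :: nat. \<forall>X :: nat set. finite X \<longrightarrow>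
       X \<in> large (rel3 S \<phi>) (12 * n ^ 2 + 12 * n + 6) \<longrightarrow> sparse g X \<longrightarrow>
       RT22_large (rel3 S \<phi>) n X)"
proof (intro exI[of _ "\<lambda>x. 32 ^ x"] conjI allI impI)
  fix n :: nat and X :: "nat set"
  assume X: "X \<in> large (rel3 S \<phi>) (12 * n ^ 2 + 12 * n + 6)" and sp: "sparse (\<lambda>x. 32 ^ x) X"
  \<comment> \<open>By the closed form the left-hand side is
    \<open>8 * n ^ 2 + 6 * n\<close>.\<close>
  have "grouping_exponent (4 * n) \<le> 12 * n ^ 2 + 12 * n + 5"
    using grouping_exponent_closed[of "4 * n"] by (simp add: power2_eq_square algebra_simps)
  moreover have "X \<in> large (rel3 S \<phi>) (Suc (12 * n ^ 2 + 12 * n + 5))"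
    using X by (simp add: numeral_eq_Suc)
  ultimately show "RT22_large (rel3 S \<phi>) n X"
    using RT22_large_exponential sp by blast
qed (rule primitive_recursive_power)

end
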